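(* Let $z_0\in\mathbb N$ and let $(X_n,Y_n)_{n\in\mathbb Z_+}$ be the simple harmonic urn process started at $(X_0,Y_0)=(z_0,0)$, with embedded process $(Z_k)_{k\in\mathbb Z_+}$. Then the Markov chain $(Z_k)$ is transient; hence so is the Markov chain $(X_n,Y_n)$.
   Context: $\mathbb Z_+=\{0,1,2,\dots\}$, $\mathbb N=\{1,2,\dots\}$, and $\operatorname{sgn}(x)=-1,0,1$ according as $x<0$, $x=0$, $x>0$. The simple harmonic urn process $(X_n,Y_n)_{n\in\mathbb Z_+}$ is the Markov chain on $\mathbb Z^2\setminus\{(0,0)\}$ with $(X_0,Y_0)=(z_0,0)$ and transition law: given $(X_n,Y_n)=(x,y)$, $$(X_{n+1},Y_{n+1})=\begin{cases}(x,y+\operatorname{sgn}(x)) & \text{with probability } \frac{|x|}{|x|+|y|},\\ (x-\operatorname{sgn}(y),y) & \text{with probability } \frac{|y|}{|x|+|y|}.\end{cases}$$ Set $\nu_0=0$ and $\nu_k=\min\{n>\nu_{k-1}: X_nY_n=0\}$ for $k\in\mathbb N$ (these are almost surely finite). Set $Z_0=z_0$ and $Z_k=|X_{\nu_k}|+|Y_{\nu_k}|$ for $k\in\mathbb N$; $(Z_k)$ is an irreducible Markov chain on $\mathbb N$, and $(X_n,Y_n)$ is irreducible on $\mathbb Z^2\setminus\{(0,0)\}$. Transient means that with probability $1$ the process eventually leaves every finite set forever (escapes to infinity). *)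

theory Defs
  imports "HOL-Probability.Probability"
begin

definition markov_chain ::
  "'w measure \<Rightarrow> 's set \<Rightarrow> ('s \<Rightarrow> 's pmf) \<Rightarrow> (nat \<Rightarrow> 'w \<Rightarrow> 's) \<Rightarrow> bool" where
  "markov_chain M S K W \<longleftrightarrow>
     prob_space M \<and>
     (\<forall>n. W n \<in> M \<rightarrow>\<^sub>M count_space S) \<and>
     (\<forall>n s. \<P>(\<omega> in M. \<forall>i\<le>n. W i \<omega> = s i) > 0 \<longrightarrow>
        \<P>(\<omega> in M. W (Suc n) \<omega> = s (Suc n) \<bar> \<forall>i\<le>n. W i \<omega> = s i) = pmf (K (s n)) (s (Suc n)))"

definition transient_process :: "'w measure \<Rightarrow> (nat \<Rightarrow> 'w \<Rightarrow> 's) \<Rightarrow> bool" where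
  "transient_process M W \<longleftrightarrow>
     (AE \<omega> in M. \<forall>F. finite F \<longrightarrow> (\<forall>\<^sub>F n in sequentially. W n \<omega> \<notin> F))"

text \<open>The value of the kernel at \<open>(0, 0)\<close>, which is not a state, is irrelevant.\<close>

definition urn_kernel :: "int \<times> int \<Rightarrow> (int \<times> int) pmf" where
  "urn_kernel = (\<lambda>(x, y).
     map_pmf (\<lambda>b. if b then (x, y + sgn x) else (x - sgn y, y))
       (bernoulli_pmf (real_of_int \<bar>x\<bar> / (real_of_int \<bar>x\<bar> + real_of_int \<bar>y\<bar>))))"

definition simple_harmonic_urn ::
  "'w measure \<Rightarrow> nat \<Rightarrow> (nat \<Rightarrow> 'w \<Rightarrow> int) \<Rightarrow> (nat \<Rightarrow> 'w \<Rightarrow> int) \<Rightarrow> bool" where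
  "simple_harmonic_urn M z0 X Y \<longleftrightarrow>
     markov_chain M (UNIV - {(0, 0)}) urn_kernel (\<lambda>n \<omega>. (X n \<omega>, Y n \<omega>)) \<and>
     (AE \<omega> in M. X 0 \<omega> = int z0 \<and> Y 0 \<omega> = 0)"

text \<open>
  The times \<open>\<nu>\<^sub>k\<close> are almost surely finite; on the null set of paths with only finitely many
  visits to the axes \<open>LEAST\<close> eventually returns an unspecified number.
\<close>

primrec axis_time ::
  "(nat \<Rightarrow> 'w \<Rightarrow> int) \<Rightarrow> (nat \<Rightarrow> 'w \<Rightarrow> int) \<Rightarrow> nat \<Rightarrow> 'w \<Rightarrow> nat" where
  "axis_time X Y 0 \<omega> = 0"
| "axis_time X Y (Suc k) \<omega> = (LEAST n. n > axis_time X Y k \<omega> \<and> X n \<omega> * Y n \<omega> = 0)"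

text \<open>For \<open>k = 0\<close> this gives \<open>Z\<^sub>0 = z\<^sub>0\<close> almost surely, since the urn starts at \<open>(z\<^sub>0, 0)\<close>.\<close>

definition embedded_process ::
  "(nat \<Rightarrow> 'w \<Rightarrow> int) \<Rightarrow> (nat \<Rightarrow> 'w \<Rightarrow> int) \<Rightarrow> nat \<Rightarrow> 'w \<Rightarrow> nat" where
  "embedded_process X Y k \<omega> =
     nat (\<bar>X (axis_time X Y k \<omega>) \<omega>\<bar> + \<bar>Y (axis_time X Y k \<omega>) \<omega>\<bar>)"

end

theory Submission
  imports Defs
begin

text \<open>
  In the quadrant \<open>x, y \<ge> 0\<close> put \<open>U = (x\<^sup>2 + y\<^sup>2)\<^sup>2 + 5/3 x y (y - x)\<close> and continue \<open>U\<close> to the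
  plane by quarter turns. Per unit of rate, \<open>U\<close> has drift about
  \<open>(x + y) ((x\<^sup>2 + y\<^sup>2) / 3 + 9 x y)\<close> and quadratic variation about
  \<open>16 x y (x + y) (x\<^sup>2 + y\<^sup>2)\<^sup>2\<close>. The cubic term spreads the drift around the circle in such a way
  that \<open>U\<close> times the drift exceeds \<open>9/16\<close> of the quadratic variation in every direction, so
  \<open>U powr (-1/16)\<close> is strictly superharmonic outside a bounded set. Truncating it from above yields
  a bounded function that is superharmonic everywhere and strictly so at all large states;
  hence the expected number of visits to each large state is finite. Every state leads to a
  large one, so all states have finite expected number of visits, and Borel-Cantelli applies.

  The axes are visited infinitely often: otherwise the coordinate that moves towards \<open>0\<close> is
  eventually constant, so that the path is eventually deterministic, which has probability \<open>0\<close>.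
  Thus the embedded process is a restriction of the urn to times tending to infinity.
\<close>

section \<open>A Lyapunov function in the quadrant\<close>

text \<open>With \<open>c\<close> in place of \<open>5/3\<close> the leading drift is \<open>(x + y)
  * ((2 - c) * (x\<^sup>2 + y\<^sup>2) + (4 + 3 * c) * (x * y))\<close>. For \<open>c = 0\<close>,
  \<open>U\<close> times the drift on the diagonal is to leading order half the quadratic variation,
  the critical value; \<open>c < 2\<close> keeps the drift positive on the axes. The choice
  \<open>c = 5/3\<close> gives \<open>4 + 3 * c = 9 = 9/16 * 16\<close>.\<close>

definition quad_lyap :: "real \<Rightarrow> real \<Rightarrow> real" where
  "quad_lyap x y = (x\<^sup>2 + y\<^sup>2)\<^sup>2 + 5/3 * (x * y * (y - x))"

text \<open>The first-order contributions of the quartic term,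
  \<open>x * (4 * y * r\<^sup>2)\<close> and \<open>- y * (4 * x * r\<^sup>2)\<close> with
  \<open>r\<close> the radius, cancel because the mean motion is a rotation. The rest is divisible
  by the total rate \<open>x + y\<close>.\<close>

lemma quad_lyap_drift:
  "x * (quad_lyap x (y + 1) - quad_lyap x y) + y * (quad_lyap (x - 1) y - quad_lyap x y) =
   (x + y) * ((x\<^sup>2 + y\<^sup>2) / 3 + 9 * (x * y) + 1 + 5/3 * (x - y))"
  unfolding quad_lyap_def by (simp add: power2_eq_square field_simps)

text \<open>The leading part of each jump comes from the quartic term; the rest is at most
  \<open>(2 + 9 + 5) * r\<^sup>2\<close>.\<close>

lemma quad_lyap_increments:
  assumes "x \<ge> 0" "y \<ge> 0" "r \<ge> 1" and r: "r\<^sup>2 = x\<^sup>2 + y\<^sup>2"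
  shows "\<bar>quad_lyap x (y + 1) - quad_lyap x y - 4 * y * r\<^sup>2\<bar> \<le> 16 * r\<^sup>2"
    and "\<bar>quad_lyap (x - 1) y - quad_lyap x y + 4 * x * r\<^sup>2\<bar> \<le> 16 * r\<^sup>2"
    and "quad_lyap x y \<ge> r ^ 4 - 5/3 * r ^ 3"
proof -
  have xr: "x \<le> r" "y \<le> r"
    by (rule power2_le_imp_le; use assms in simp)+
  have "\<bar>2*y+1\<bar> \<le> \<bar>3*r\<bar>" "\<bar>1-2*x\<bar> \<le> \<bar>3*r\<bar>"
    using assms xr by auto
  then have sq: "(2*y+1)\<^sup>2 \<le> 9 * r\<^sup>2" "(1-2*x)\<^sup>2 \<le> 9 * r\<^sup>2"
    by (auto simp: abs_le_square_iff power_mult_distrib)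
  have m1: "\<bar>x * (2*y+1-x)\<bar> \<le> r * (3 * r)" "\<bar>y * (2*x-y-1)\<bar> \<le> r * (3 * r)"
    unfolding abs_mult using assms xr by (intro mult_mono; simp add: abs_le_iff)+
  have r2: "r * (3 * r) = 3 * r\<^sup>2"
    by (simp add: power2_eq_square)
  have m2: "\<bar>x * y * (y - x)\<bar> \<le> r * r * r"
    unfolding abs_mult using assms xr by (intro mult_mono; simp add: abs_le_iff)
  have "quad_lyap x (y + 1) - quad_lyap x y - 4 * y * r\<^sup>2 =
      2 * r\<^sup>2 + (2*y+1)\<^sup>2 + 5/3 * (x * (2*y+1-x))"
    unfolding quad_lyap_def r by (simp add: power2_eq_square field_simps)
  then show "\<bar>quad_lyap x (y + 1) - quad_lyap x y - 4 * y * r\<^sup>2\<bar> \<le> 16 * r\<^sup>2"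
    using sq(1) m1(1) zero_le_power2[of "2*y+1"] zero_le_power2[of r]
    unfolding r2 abs_le_iff by linarith
  have "quad_lyap (x - 1) y - quad_lyap x y + 4 * x * r\<^sup>2 =
      2 * r\<^sup>2 + (1-2*x)\<^sup>2 + 5/3 * (y * (2*x-y-1))"
    unfolding quad_lyap_def r by (simp add: power2_eq_square field_simps)
  then show "\<bar>quad_lyap (x - 1) y - quad_lyap x y + 4 * x * r\<^sup>2\<bar> \<le> 16 * r\<^sup>2"
    using sq(2) m1(2) zero_le_power2[of "1-2*x"] zero_le_power2[of r]
    unfolding r2 abs_le_iff by linarith
  have "r ^ 4 = (x\<^sup>2 + y\<^sup>2)\<^sup>2"
    by (simp flip: r)
  then show "quad_lyap x y \<ge> r ^ 4 - 5/3 * r ^ 3"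
    unfolding quad_lyap_def using m2 by (simp add: power3_eq_cube abs_le_iff)
qed

text \<open>Jumps are of order \<open>r ^ 3\<close> and \<open>quad_lyap\<close> is of order
  \<open>r ^ 4\<close>. The ratio \<open>1/20\<close> is the range of the power expansion in
  \<open>one_plus_powr_le\<close>.\<close>

lemma quad_lyap_increments_small:
  assumes "x \<ge> 0" "y \<ge> 0" "x\<^sup>2 + y\<^sup>2 \<ge> 2000\<^sup>2"
  shows "quad_lyap x y > 0"
    and "\<bar>quad_lyap x (y + 1) - quad_lyap x y\<bar> \<le> quad_lyap x y / 20"
    and "\<bar>quad_lyap (x - 1) y - quad_lyap x y\<bar> \<le> quad_lyap x y / 20"
proof -
  define r where "r = sqrt (x\<^sup>2 + y\<^sup>2)"
  have r: "r\<^sup>2 = x\<^sup>2 + y\<^sup>2" "r \<ge> 2000"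
    unfolding r_def using assms(3) by (auto intro: real_le_rsqrt)
  have r1: "r \<ge> 1" using r by simp
  note inc = quad_lyap_increments[OF assms(1,2) r1 r(1)]
  have xr: "x \<le> r" "y \<le> r"
    by (rule power2_le_imp_le; use r r1 in simp)+
  have r32: "2000 * r\<^sup>2 \<le> r ^ 3" "2000 * r ^ 3 \<le> r ^ 4"
    using r(2) by (auto simp: power2_eq_square power3_eq_cube power4_eq_xxxx intro!: mult_right_mono)
  have r3: "r ^ 3 > 0"
    using r(2) by simp
  have b: "\<bar>4 * y * r\<^sup>2\<bar> \<le> 4 * r ^ 3" "\<bar>4 * x * r\<^sup>2\<bar> \<le> 4 * r ^ 3"
    using xr assms by (auto simp: power2_eq_square power3_eq_cube abs_mult intro!: mult_right_mono)
  show "quad_lyap x y > 0"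
    "\<bar>quad_lyap x (y + 1) - quad_lyap x y\<bar> \<le> quad_lyap x y / 20"
    "\<bar>quad_lyap (x - 1) y - quad_lyap x y\<bar> \<le> quad_lyap x y / 20"
    using inc r(2) r32 r3 b unfolding abs_le_iff by linarith+
qed

text \<open>Both sides contain the mixed term \<open>9 * (x * y) * (x + y) * r ^ 4\<close>. The
  remaining drift contributes \<open>(x + y) * r ^ 6 / 3\<close>, of order \<open>r ^ 7\<close>,
  against errors of order \<open>r ^ 6\<close>.\<close>

lemma quad_lyap_drift_dominates:
  assumes "x \<ge> 0" "y \<ge> 0" "x\<^sup>2 + y\<^sup>2 \<ge> 2000\<^sup>2"
  defines "U \<equiv> quad_lyap x y"
  defines "a \<equiv> quad_lyap x (y + 1) - U"
  defines "b \<equiv> quad_lyap (x - 1) y - U"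
  shows "9/16 * (x * a\<^sup>2 + y * b\<^sup>2) < U * (x * a + y * b)"
proof -
  define r where "r = sqrt (x\<^sup>2 + y\<^sup>2)"
  have r: "r\<^sup>2 = x\<^sup>2 + y\<^sup>2" "r \<ge> 2000"
    unfolding r_def using assms(3) by (auto intro: real_le_rsqrt)
  have r1: "r \<ge> 1" using r by simp
  note inc = quad_lyap_increments[OF assms(1,2) r1 r(1)]
  have xr: "x \<le> r" "y \<le> r"
    by (rule power2_le_imp_le; use r r1 in simp)+
  have xyr: "x * y \<le> r\<^sup>2"
    using mult_mono[OF xr] assms r by (simp add: power2_eq_square)
  have xy0: "x * y \<ge> 0"
    using assms by simp
  have r56: "r ^ 5 * 2000 \<le> r ^ 6"
    using mult_left_mono[OF r(2), of "r ^ 5"] r(2) by (simp add: power_numeral_reduce mult_ac)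
  \<comment> \<open>Serves both jumps: \<open>(u, v, w)\<close> is \<open>(x, a, y)\<close> for the
    first and \<open>(y, b, -x)\<close> for the second.\<close>
  have square_bound: "u * v\<^sup>2 \<le> 16 * (u * w * w) * r ^ 4 + 384 * r ^ 6"
    if "\<bar>v - 4 * w * r\<^sup>2\<bar> \<le> 16 * r\<^sup>2" "0 \<le> u" "u \<le> r" "\<bar>w\<bar> \<le> r" for u v w
  proof -
    define e where "e = v - 4 * w * r\<^sup>2"
    have e: "\<bar>e\<bar> \<le> 16 * r\<^sup>2" using that e_def by simp
    have "\<bar>u * w * e\<bar> \<le> r * r * (16 * r\<^sup>2)"
      unfolding abs_mult using that e r1 by (intro mult_mono) auto
    then have 1: "8 * r\<^sup>2 * (u * w * e) \<le> 8 * r\<^sup>2 * (r * r * (16 * r\<^sup>2))"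
      by (intro mult_left_mono) auto
    have "e\<^sup>2 \<le> (16 * r\<^sup>2)\<^sup>2"
      using power_mono[OF e, of 2] by simp
    then have 2: "u * e\<^sup>2 \<le> r * (16 * r\<^sup>2)\<^sup>2"
      using that r1 by (intro mult_mono) auto
    have "u * v\<^sup>2 = 16 * (u * w * w) * r ^ 4 + 8 * r\<^sup>2 * (u * w * e) + u * e\<^sup>2"
      unfolding e_def by (simp add: power2_eq_square power4_eq_xxxx algebra_simps)
    also have "\<dots> \<le> 16 * (u * w * w) * r ^ 4 + 8 * r\<^sup>2 * (r * r * (16 * r\<^sup>2)) + r * (16 * r\<^sup>2)\<^sup>2"
      using 1 2 by linarith
    also have "\<dots> = 16 * (u * w * w) * r ^ 4 + 128 * r ^ 6 + 256 * r ^ 5"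
      by (simp add: power_numeral_reduce)
    also have "\<dots> \<le> 16 * (u * w * w) * r ^ 4 + 384 * r ^ 6"
    proof -
      have "r ^ 5 \<le> r ^ 6" using r1 by (intro power_increasing) auto
      then show ?thesis by linarith
    qed
    finally show ?thesis .
  qed
  have "x * a\<^sup>2 \<le> 16 * (x * y * y) * r ^ 4 + 384 * r ^ 6"
    using inc(1) assms(1,2) xr unfolding a_def U_def by (intro square_bound) auto
  moreover have "y * b\<^sup>2 \<le> 16 * (y * (-x) * (-x)) * r ^ 4 + 384 * r ^ 6"
    using inc(2) assms(1,2) xr unfolding b_def U_def by (intro square_bound) auto
  ultimately have E2: "9/16 * (x * a\<^sup>2 + y * b\<^sup>2) \<le> 9 * (x * y) * (x + y) * r ^ 4 + 432 * r ^ 6"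
    by (simp add: algebra_simps)
  have "(r\<^sup>2/3 + 9 * (x*y) - 5/3 * r) * (r ^ 4 - 5/3 * r ^ 3) \<le>
        (r\<^sup>2/3 + 9 * (x*y) + 1 + 5/3 * (x - y)) * U"
  proof (rule mult_mono)
    show "r\<^sup>2/3 + 9 * (x*y) - 5/3 * r \<le> r\<^sup>2/3 + 9 * (x*y) + 1 + 5/3 * (x - y)"
      using xr assms(1) by argo
    have "2000 * r \<le> r\<^sup>2" using r(2) by (simp add: power2_eq_square)
    then show "0 \<le> r\<^sup>2/3 + 9 * (x*y) + 1 + 5/3 * (x - y)"
      using xr assms(1,2) xy0 r1 by argo
    have "2000 * r ^ 3 \<le> r ^ 4" 
      using r(2) by (simp add: power3_eq_cube power4_eq_xxxx)
    moreover have "r ^ 3 \<ge> 0"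
      using r1 by simp
    ultimately show "0 \<le> r ^ 4 - 5/3 * r ^ 3"
      by linarith
  qed (use inc in \<open>simp add: U_def\<close>)
  \<comment> \<open>The coefficient \<open>18\<close> rounds up \<open>20/9 + 15\<close>, where
    \<open>15\<close> comes from \<open>x * y \<le> r\<^sup>2\<close>.\<close>
  moreover have "(r\<^sup>2/3 + 9 * (x*y) - 5/3 * r) * (r ^ 4 - 5/3 * r ^ 3) \<ge>
      9 * (x * y) * r ^ 4 + r ^ 6 / 3 - 18 * r ^ 5"
  proof -
    have "(r\<^sup>2/3 + 9 * (x*y) - 5/3 * r) * (r ^ 4 - 5/3 * r ^ 3) =
      9 * (x * y) * r ^ 4 + r ^ 6 / 3 - (20/9) * r ^ 5 - 15 * r ^ 3 * (x * y) + 25/9 * r ^ 4"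
      by (simp add: power_numeral_reduce algebra_simps)
    moreover have "15 * r ^ 3 * (x * y) \<le> 15 * r ^ 3 * r\<^sup>2"
      using xyr r1 by (intro mult_left_mono) auto
    moreover have "r ^ 3 * r\<^sup>2 = r ^ 5" by (simp add: power_numeral_reduce)
    moreover have "r ^ 4 \<ge> 0" "r ^ 5 \<ge> 0" using r1 by auto
    ultimately show ?thesis by linarith
  qed
  ultimately have AU: "9 * (x * y) * r ^ 4 + r ^ 6 / 3 - 18 * r ^ 5 \<le>
        (r\<^sup>2/3 + 9 * (x*y) + 1 + 5/3 * (x - y)) * U"
    by linarith
  have xyge: "r \<le> x + y"
    unfolding r_def using assms(1,2) by (rule sqrt_sum_squares_le_sum)
  \<comment> \<open>This amounts to \<open>432 + 18 < r / 3\<close>, that is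
    \<open>r > 1350\<close>, which the radius \<open>2000\<close> ensures.\<close>
  have slack: "432 * r ^ 6 < r * (r ^ 6 / 3 - 18 * r ^ 5)"
  proof -
    have "450 * r ^ 6 < (r / 3) * r ^ 6"
      using r(2) by (intro mult_strict_right_mono) auto
    then show ?thesis
      by (simp add: power_numeral_reduce algebra_simps)
  qed
  also have "\<dots> \<le> (x + y) * (r ^ 6 / 3 - 18 * r ^ 5)"
  proof (intro mult_right_mono[OF xyge])
    have "r ^ 5 \<ge> 0" using r1 by simp
    then show "0 \<le> r ^ 6 / 3 - 18 * r ^ 5" using r56 by linarith
  qed
  finally have "9 * (x * y) * (x + y) * r ^ 4 + 432 * r ^ 6 <
      (x + y) * (9 * (x * y) * r ^ 4 + r ^ 6 / 3 - 18 * r ^ 5)"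
    by (simp add: algebra_simps)
  also have "\<dots> \<le> (x + y) * ((r\<^sup>2/3 + 9 * (x*y) + 1 + 5/3 * (x - y)) * U)"
    using AU assms by (intro mult_left_mono) auto
  also have "\<dots> = U * (x * a + y * b)"
    unfolding a_def b_def U_def quad_lyap_drift r by simp
  finally show ?thesis
    using E2 by linarith
qed

section \<open>A second-order bound for a negative power\<close>

text \<open>The Taylor coefficient of \<open>t\<^sup>2\<close> is \<open>17/512\<close>, so
  \<open>9/256\<close> leaves a margin of \<open>1/512\<close> for the remainder. The difference of
  logarithms \<open>h\<close> vanishes at \<open>0\<close> and its derivative has the sign of
  \<open>t\<close>.\<close>

lemma one_plus_powr_le:
  fixes t :: real
  assumes "\<bar>t\<bar> \<le> 1/20"
  shows "(1 + t) powr (-1/16) \<le> 1 - t/16 + 9/256 * t\<^sup>2"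
proof -
  define q where "q t = 1 - t/16 + 9/256 * t\<^sup>2" for t :: real
  define h where "h t = ln (q t) + ln (1 + t) / 16" for t :: real
  define h' where "h' t = (9/128 * t - 1/16) / q t + 1/16 / (1 + t)" for t :: real
  have qpos: "q t > 0" if "\<bar>t\<bar> \<le> 1/20" for t
    using that zero_le_power2[of t] unfolding q_def by linarith
  have deriv: "(h has_real_derivative h' t) (at t)" if "\<bar>t\<bar> \<le> 1/20" for t
  proof -
    have q': "(q has_real_derivative (9/128 * t - 1/16)) (at t)"
      unfolding q_def by (auto intro!: derivative_eq_intros)
    have l': "((\<lambda>t. 1 + t) has_real_derivative 1) (at t)"
      by (auto intro!: derivative_eq_intros)
    have pos: "1 + t > 0" using that by auto
    show ?thesis
      unfolding h_def h'_def
      by (rule DERIV_cong[OF DERIV_add[OF DERIV_chain2[OF DERIV_ln[OF qpos[OF that]] q']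
            DERIV_cdivide[OF DERIV_chain2[OF DERIV_ln[OF pos] l'], of 16]]])
        (simp add: inverse_eq_divide)
  qed
  \<comment> \<open>The factor \<open>1/256 + 297/4096 * t\<close> is positive for
    \<open>t > -16/297\<close>, in particular on the range \<open>1/20\<close>.\<close>
  have h': "h' t = t * (1/256 + 297/4096 * t) / (q t * (1 + t))" if "\<bar>t\<bar> \<le> 1/20" for t
  proof -
    have "q t \<noteq> 0" "1 + t \<noteq> 0" using qpos[OF that] that by auto
    then have "h' t = ((9/128 * t - 1/16) * (1 + t) + 1/16 * q t) / (q t * (1 + t))"
      unfolding h'_def by (rule add_frac_eq)
    also have "(9/128 * t - 1/16) * (1 + t) + 1/16 * q t = t * (1/256 + 297/4096 * t)"
      unfolding q_def by (simp add: field_simps power2_eq_square)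
    finally show ?thesis .
  qed
  have den: "q t * (1 + t) > 0" if "\<bar>t\<bar> \<le> 1/20" for t
    using qpos[OF that] that by simp
  have "h 0 \<le> h t"
  proof (cases "t \<ge> 0")
    case True
    show ?thesis
    proof (rule DERIV_nonneg_imp_nondecreasing[OF True])
      fix u assume u: "0 \<le> u" "u \<le> t"
      then have a: "\<bar>u\<bar> \<le> 1/20" using assms by simp
      have "h' u \<ge> 0" unfolding h'[OF a]
        using u a den[OF a] by (intro divide_nonneg_pos mult_nonneg_nonneg) auto
      then show "\<exists>y. (h has_real_derivative y) (at u) \<and> y \<ge> 0"
        using deriv[OF a] by blast
    qed
  next
    case False
    show ?thesis
    proof (rule DERIV_nonpos_imp_nonincreasing[of t 0])
      show "t \<le> 0" using False by simp
    next
      fix u assume u: "t \<le> u" "u \<le> 0"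
      then have a: "\<bar>u\<bar> \<le> 1/20" using assms by simp
      have "h' u \<le> 0" unfolding h'[OF a]
        using u a den[OF a] by (intro divide_nonpos_pos mult_nonpos_nonneg) auto
      then show "\<exists>y. (h has_real_derivative y) (at u) \<and> y \<le> 0"
        using deriv[OF a] by blast
    qed
  qed
  then have "- ln (1 + t) / 16 \<le> ln (q t)"
    unfolding h_def q_def by simp
  then have "exp (- ln (1 + t) / 16) \<le> q t"
    using qpos[OF assms] by (simp add: ln_ge_iff)
  then show ?thesis
    using assms unfolding q_def powr_def by (auto simp: algebra_simps split: if_splits)
qed

section \<open>Markov chains with countable state space\<close>

lemma nn_integral_count_space_swap:
  fixes f :: "'a::countable \<Rightarrow> 'b::countable \<Rightarrow> ennreal"
  shows "(\<integral>\<^sup>+x. \<integral>\<^sup>+y. f x y \<partial>count_space UNIV \<partial>count_space UNIV) =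
         (\<integral>\<^sup>+y. \<integral>\<^sup>+x. f x y \<partial>count_space UNIV \<partial>count_space UNIV)"
proof -
  interpret pair_sigma_finite "count_space (UNIV :: 'b set)" "count_space (UNIV :: 'a set)"
    by (intro pair_sigma_finite.intro sigma_finite_measure_count_space)
  have "count_space UNIV \<Otimes>\<^sub>M count_space UNIV = (count_space UNIV :: ('b \<times> 'a) measure)"
    by (subst pair_measure_countable) auto
  then show ?thesis
    by (intro Fubini') simp
qed

locale countable_markov_chain = prob_space M for M :: "'w measure" +
  fixes S :: "'s::countable set" and K :: "'s \<Rightarrow> 's pmf" and W :: "nat \<Rightarrow> 'w \<Rightarrow> 's"
  assumes chain: "markov_chain M S K W"
begin

lemma pred_state [measurable]: "Measurable.pred M (\<lambda>\<omega>. W n \<omega> = s)"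
proof -
  have "W n \<in> M \<rightarrow>\<^sub>M count_space S"
    using chain by (simp add: markov_chain_def)
  from measurable_sets[OF this, of "{s} \<inter> S"] measurable_space[OF this]
  have "W n -` ({s} \<inter> S) \<inter> space M \<in> sets M" "W n -` ({s} \<inter> S) \<inter> space M = {\<omega> \<in> space M. W n \<omega> = s}"
    by auto
  then show ?thesis
    by (simp add: pred_def)
qed

lemma emeasure_split_state:
  assumes [measurable]: "Measurable.pred M P"
  shows "emeasure M {\<omega> \<in> space M. P \<omega>} =
    (\<integral>\<^sup>+v. emeasure M {\<omega> \<in> space M. W n \<omega> = v \<and> P \<omega>} \<partial>count_space UNIV)"
proof -
  have "{\<omega> \<in> space M. P \<omega>} = (\<Union>v. {\<omega> \<in> space M. W n \<omega> = v \<and> P \<omega>})"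
    by auto
  also have "emeasure M \<dots> = (\<integral>\<^sup>+v. emeasure M {\<omega> \<in> space M. W n \<omega> = v \<and> P \<omega>} \<partial>count_space UNIV)"
    by (rule emeasure_UN_countable) (auto simp: disjoint_family_on_def)
  finally show ?thesis .
qed

text \<open>\<open>markov_chain\<close> conditions on the whole past from time \<open>0\<close>.
  Induction on \<open>N\<close> sums over the state at the earliest time and so discards the past
  step by step; the product form also covers null events.\<close>

lemma emeasure_path_Suc:
  assumes "N \<le> n"
  shows "emeasure M {\<omega> \<in> space M. \<forall>i\<in>{N..Suc n}. W i \<omega> = s i} =
    emeasure M {\<omega> \<in> space M. \<forall>i\<in>{N..n}. W i \<omega> = s i} * pmf (K (s n)) (s (Suc n))"
  using assms
proof (induction N arbitrary: s)
  case 0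
  define A where "A = {\<omega> \<in> space M. \<forall>i\<le>n. W i \<omega> = s i}"
  define B where "B = {\<omega> \<in> space M. W (Suc n) \<omega> = s (Suc n) \<and> (\<forall>i\<le>n. W i \<omega> = s i)}"
  have [measurable]: "A \<in> sets M"
    unfolding A_def by measurable
  have "prob B = prob A * pmf (K (s n)) (s (Suc n))"
  proof (cases "prob A > 0")
    case True
    then have "\<P>(\<omega> in M. W (Suc n) \<omega> = s (Suc n) \<bar> \<forall>i\<le>n. W i \<omega> = s i) = pmf (K (s n)) (s (Suc n))"
      using chain by (auto simp: markov_chain_def A_def)
    then show ?thesis
      using True by (simp add: cond_prob_def A_def B_def field_simps)
  next
    case False
    have "prob B \<le> prob A"
      by (rule finite_measure_mono) (auto simp: A_def B_def)
    then show ?thesis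
      using False zero_less_measure_iff[of M A] by (simp add: measure_le_0_iff)
  qed
  moreover have "{\<omega> \<in> space M. \<forall>i\<in>{0..Suc n}. W i \<omega> = s i} = B"
    by (auto simp: B_def le_Suc_eq)
  moreover have "{\<omega> \<in> space M. \<forall>i\<in>{0..n}. W i \<omega> = s i} = A"
    by (auto simp: A_def)
  ultimately show ?case
    by (simp add: emeasure_eq_measure ennreal_mult)
next
  case (Suc N)
  have split: "emeasure M {\<omega> \<in> space M. \<forall>i\<in>{Suc N..k}. W i \<omega> = s i} =
    (\<integral>\<^sup>+v. emeasure M {\<omega> \<in> space M. \<forall>i\<in>{N..k}. W i \<omega> = (s(N := v)) i} \<partial>count_space UNIV)"
    if "N \<le> k" for k
  proof -
    have "{N..k} = insert N {Suc N..k}"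
      using that by auto
    then have "{\<omega> \<in> space M. \<forall>i\<in>{N..k}. W i \<omega> = (s(N := v)) i} =
        {\<omega> \<in> space M. W N \<omega> = v \<and> (\<forall>i\<in>{Suc N..k}. W i \<omega> = s i)}" for v
      by auto
    then show ?thesis
      by (simp only:) (rule emeasure_split_state, measurable)
  qed
  show ?case
    using Suc.prems by (subst (1 2) split) (simp_all add: Suc.IH nn_integral_multc)
qed

lemma emeasure_state_step:
  "emeasure M {\<omega> \<in> space M. W n \<omega> = s \<and> W (Suc n) \<omega> = t} =
   emeasure M {\<omega> \<in> space M. W n \<omega> = s} * pmf (K s) t"
proof -
  have "{n..Suc n} = {n, Suc n}" by auto
  then show ?thesis
    using emeasure_path_Suc[of n n "\<lambda>i. if i = n then s else t"] by simp
qed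

lemma AE_state_step_in_support: "AE \<omega> in M. \<forall>n. W (Suc n) \<omega> \<in> set_pmf (K (W n \<omega>))"
proof -
  have "AE \<omega> in M. \<not> (W n \<omega> = s \<and> W (Suc n) \<omega> = t)" if "t \<notin> set_pmf (K s)" for n s t
  proof (rule AE_I)
    show "emeasure M {\<omega> \<in> space M. W n \<omega> = s \<and> W (Suc n) \<omega> = t} = 0"
      using that by (simp add: emeasure_state_step set_pmf_iff)
  qed auto
  then have "AE \<omega> in M. \<forall>n s t. t \<notin> set_pmf (K s) \<longrightarrow> \<not> (W n \<omega> = s \<and> W (Suc n) \<omega> = t)"
    unfolding AE_all_countable by auto
  then show ?thesis
    by eventually_elim blast
qed

text \<open>Each further step along the prescribed path costs a factor of at most \<open>q\<close>,
  so the probability of following it for \<open>m\<close> steps is at most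
  \<open>q ^ m\<close>.\<close>

lemma AE_leaves_path:
  fixes q :: real
  assumes "\<And>i. i \<ge> N \<Longrightarrow> pmf (K (s i)) (s (Suc i)) \<le> q" and "q < 1"
  shows "AE \<omega> in M. \<exists>i\<ge>N. W i \<omega> \<noteq> s i"
proof -
  have q0: "q \<ge> 0"
    using order_trans[OF pmf_nonneg assms(1)[OF order_refl]] .
  have bound: "prob {\<omega> \<in> space M. \<forall>i\<in>{N..N + m}. W i \<omega> = s i} \<le> q ^ m" for m
  proof (induction m)
    case (Suc m)
    have "prob {\<omega> \<in> space M. \<forall>i\<in>{N..Suc (N + m)}. W i \<omega> = s i} =
        prob {\<omega> \<in> space M. \<forall>i\<in>{N..N + m}. W i \<omega> = s i} * pmf (K (s (N + m))) (s (Suc (N + m)))"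
      using emeasure_path_Suc[of N "N + m" s]
      by (simp add: emeasure_eq_measure flip: ennreal_mult)
    also have "\<dots> \<le> q ^ m * q"
      using Suc assms(1) q0 by (intro mult_mono) auto
    finally show ?case
      by (simp add: mult.commute)
  qed simp
  define A where "A = {\<omega> \<in> space M. \<forall>i\<ge>N. W i \<omega> = s i}"
  have [measurable]: "A \<in> sets M"
    unfolding A_def by measurable
  have "prob A \<le> q ^ m" for m
  proof -
    have "prob A \<le> prob {\<omega> \<in> space M. \<forall>i\<in>{N..N + m}. W i \<omega> = s i}"
      by (rule finite_measure_mono) (auto simp: A_def)
    then show ?thesis
      using bound[of m] by simp
  qed
  then have "prob A \<le> 0"
    using assms(2) q0 by (intro LIMSEQ_le_const[OF LIMSEQ_realpow_zero]) auto
  then have "emeasure M A = 0"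
    by (simp add: emeasure_eq_measure measure_le_0_iff)
  then show ?thesis
    by (intro AE_I[where N = A]) (auto simp: A_def)
qed

section \<open>The Green function and a criterion for transience\<close>

text \<open>The expected total number of visits to \<open>s\<close>, possibly infinite.\<close>

definition green :: "'s \<Rightarrow> ennreal" where
  "green s = (\<Sum>n. emeasure M {\<omega> \<in> space M. W n \<omega> = s})"

text \<open>The mean of \<open>f (W n)\<close> never increases and drops by at least
  \<open>\<epsilon>\<close> times the probability of being at \<open>u\<close>. Summing the drops
  gives \<open>\<epsilon> * green u \<le> C\<close>.\<close>

lemma green_finite_of_supermartingale:
  fixes f :: "'s \<Rightarrow> ennreal" and C \<epsilon> :: ennreal
  assumes bounded: "\<And>s. f s \<le> C" "C < \<infinity>"
    and super: "\<And>s. (\<integral>\<^sup>+t. f t \<partial>K s) \<le> f s"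
    and strict: "(\<integral>\<^sup>+t. f t \<partial>K u) + \<epsilon> \<le> f u" and "\<epsilon> > 0"
  shows "green u < \<infinity>"
proof -
  define p where "p n s = emeasure M {\<omega> \<in> space M. W n \<omega> = s}" for n s
  define e where "e n = (\<integral>\<^sup>+s. p n s * f s \<partial>count_space UNIV)" for n
  have p_Suc: "p (Suc n) t = (\<integral>\<^sup>+s. p n s * pmf (K s) t \<partial>count_space UNIV)" for n t
    using emeasure_split_state[of "\<lambda>\<omega>. W (Suc n) \<omega> = t" n]
    by (simp add: p_def emeasure_state_step)
  have e_Suc: "e (Suc n) = (\<integral>\<^sup>+s. p n s * (\<integral>\<^sup>+t. f t \<partial>K s) \<partial>count_space UNIV)" for n
  proof -
    have "e (Suc n) = (\<integral>\<^sup>+t. \<integral>\<^sup>+s. p n s * (pmf (K s) t * f t) \<partial>count_space UNIV \<partial>count_space UNIV)"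
      by (simp add: e_def p_Suc nn_integral_multc[symmetric] mult.assoc)
    also have "\<dots> = (\<integral>\<^sup>+s. \<integral>\<^sup>+t. p n s * (pmf (K s) t * f t) \<partial>count_space UNIV \<partial>count_space UNIV)"
      by (rule nn_integral_count_space_swap)
    finally show ?thesis
      by (simp add: nn_integral_cmult nn_integral_measure_pmf)
  qed
  have step: "e (Suc n) + \<epsilon> * p n u \<le> e n" for n
  proof -
    have "e (Suc n) + \<epsilon> * p n u =
      (\<integral>\<^sup>+s. p n s * (\<integral>\<^sup>+t. f t \<partial>K s) \<partial>count_space UNIV) +
      (\<integral>\<^sup>+s. p n s * (\<epsilon> * indicator {u} s) \<partial>count_space UNIV)"
      by (simp add: e_Suc mult.assoc[symmetric] mult.commute)
    also have "\<dots> = (\<integral>\<^sup>+s. p n s * (\<integral>\<^sup>+t. f t \<partial>K s) + p n s * (\<epsilon> * indicator {u} s) \<partial>count_space UNIV)"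
      by (rule nn_integral_add[symmetric]) auto
    also have "\<dots> \<le> e n"
      unfolding e_def distrib_left[symmetric] using super strict
      by (intro nn_integral_mono mult_left_mono) (auto simp: indicator_def)
    finally show ?thesis .
  qed
  have "e n + (\<Sum>i<n. \<epsilon> * p i u) \<le> e 0" for n
  proof (induction n)
    case (Suc n)
    have "e (Suc n) + (\<Sum>i<Suc n. \<epsilon> * p i u) = (e (Suc n) + \<epsilon> * p n u) + (\<Sum>i<n. \<epsilon> * p i u)"
      by (simp add: ac_simps)
    also have "\<dots> \<le> e n + (\<Sum>i<n. \<epsilon> * p i u)"
      using step by (intro add_right_mono)
    finally show ?case
      using Suc.IH by (rule order_trans)
  qed simp
  then have "(\<Sum>i<n. \<epsilon> * p i u) \<le> e 0" for n
    using order_trans[OF add_increasing[OF zero_le order_refl]] by blast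
  then have "(\<Sum>i. \<epsilon> * p i u) \<le> e 0"
    by (intro suminf_le_const) auto
  also have "e 0 \<le> (\<integral>\<^sup>+s. p 0 s * C \<partial>count_space UNIV)"
    unfolding e_def using bounded by (intro nn_integral_mono mult_left_mono) auto
  also have "\<dots> = (\<integral>\<^sup>+s. p 0 s \<partial>count_space UNIV) * C"
    by (rule nn_integral_multc) auto
  also have "(\<integral>\<^sup>+s. p 0 s \<partial>count_space UNIV) = 1"
    using emeasure_split_state[of "\<lambda>_. True" 0] by (simp add: p_def emeasure_space_1)
  finally have "\<epsilon> * green u \<le> C"
    by (simp add: green_def p_def)
  then show ?thesis
    using \<open>\<epsilon> > 0\<close> bounded(2)
    by (auto simp: less_top[symmetric] ennreal_mult_top top_unique split: if_splits)
qed

text \<open>Each visit to \<open>s\<close> is followed by one to \<open>t\<close> with probability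
  \<open>pmf (K s) t\<close>, so \<open>green s * pmf (K s) t \<le> green t\<close>.\<close>

lemma green_finite_of_step:
  assumes "green t < \<infinity>" and "pmf (K s) t > 0"
  shows "green s < \<infinity>"
proof -
  have "green s * pmf (K s) t = (\<Sum>n. emeasure M {\<omega> \<in> space M. W n \<omega> = s} * pmf (K s) t)"
    by (simp add: green_def)
  also have "\<dots> \<le> (\<Sum>n. emeasure M {\<omega> \<in> space M. W (Suc n) \<omega> = t})"
    unfolding emeasure_state_step[symmetric]
    by (intro suminf_le emeasure_mono) auto
  also have "\<dots> \<le> green t"
    unfolding green_def by (subst (2) suminf_offset[where i = 1]) auto
  finally show ?thesis
    using assms by (auto simp: less_top[symmetric] ennreal_top_mult top_unique)
qed

lemma transient_of_green_finite:
  assumes "\<And>s. s \<in> S \<Longrightarrow> green s < \<infinity>"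
  shows "transient_process M W"
proof -
  have "AE \<omega> in M. \<forall>\<^sub>F n in sequentially. W n \<omega> \<noteq> s" for s
  proof (cases "s \<in> S")
    case True
    have "AE \<omega> in M. \<forall>\<^sub>F n in sequentially. \<omega> \<in> space M - {\<omega> \<in> space M. W n \<omega> = s}"
    proof (rule borel_cantelli_AE1)
      show "summable (\<lambda>n. prob {\<omega> \<in> space M. W n \<omega> = s})"
        using assms[OF True] unfolding green_def emeasure_eq_measure
        by (intro summable_suminf_not_top) auto
    qed (auto simp: emeasure_eq_measure)
    then show ?thesis
      by eventually_elim (auto elim: eventually_mono)
  next
    case False
    have "W n \<in> M \<rightarrow>\<^sub>M count_space S" for n
      using chain by (simp add: markov_chain_def)
    from measurable_space[OF this] False show ?thesis
      by (intro AE_I2 always_eventually) auto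
  qed
  then have "AE \<omega> in M. \<forall>s. \<forall>\<^sub>F n in sequentially. W n \<omega> \<noteq> s"
    by (simp add: AE_all_countable)
  then show ?thesis
    unfolding transient_process_def
  proof eventually_elim
    case (elim \<omega>)
    show ?case
    proof (intro allI impI)
      fix F :: "'s set" assume "finite F"
      then have "\<forall>\<^sub>F n in sequentially. \<forall>s\<in>F. W n \<omega> \<noteq> s"
        using elim by (intro eventually_ball_finite) auto
      then show "\<forall>\<^sub>F n in sequentially. W n \<omega> \<notin> F"
        by (rule eventually_mono) auto
    qed
  qed
qed

end

section \<open>Superharmonic function for the urn\<close>

text \<open>The absolute values encode the quarter turns in one formula. The cubic term vanishes on
  the axes, so adjacent quadrants agree there.\<close>

definition urn_lyap :: "int \<times> int \<Rightarrow> real" where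
  "urn_lyap = (\<lambda>(x, y). ((real_of_int x)\<^sup>2 + (real_of_int y)\<^sup>2)\<^sup>2
     + 5/3 * (real_of_int x * real_of_int y * (\<bar>real_of_int y\<bar> - \<bar>real_of_int x\<bar>)))"

lemma urn_lyap_quadrant:
  shows "x \<ge> 0 \<Longrightarrow> y \<ge> 0 \<Longrightarrow> urn_lyap (x, y) = quad_lyap x y"
    and "x \<le> 0 \<Longrightarrow> y \<le> 0 \<Longrightarrow> urn_lyap (x, y) = quad_lyap (- x) (- y)"
    and "x \<le> 0 \<Longrightarrow> y \<ge> 0 \<Longrightarrow> urn_lyap (x, y) = quad_lyap y (- x)"
    and "x \<ge> 0 \<Longrightarrow> y \<le> 0 \<Longrightarrow> urn_lyap (x, y) = quad_lyap (- y) x"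
  by (simp_all add: urn_lyap_def quad_lyap_def algebra_simps)

lemma nn_integral_urn_kernel:
  assumes "(x, y) \<noteq> (0, 0)"
  shows "(\<integral>\<^sup>+t. f t \<partial>urn_kernel (x, y)) =
    f (x, y + sgn x) * ennreal (real_of_int \<bar>x\<bar> / (real_of_int \<bar>x\<bar> + real_of_int \<bar>y\<bar>)) + 
    f (x - sgn y, y) * ennreal (real_of_int \<bar>y\<bar> / (real_of_int \<bar>x\<bar> + real_of_int \<bar>y\<bar>))"
proof -
  define p where "p = real_of_int \<bar>x\<bar> / (real_of_int \<bar>x\<bar> + real_of_int \<bar>y\<bar>)"
  have "real_of_int \<bar>x\<bar> + real_of_int \<bar>y\<bar> > 0"
    using assms by auto
  then have p: "1 - p = real_of_int \<bar>y\<bar> / (real_of_int \<bar>x\<bar> + real_of_int \<bar>y\<bar>)" "0 \<le> p" "p \<le> 1"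
    by (simp_all add: p_def field_simps)
  show ?thesis
    unfolding urn_kernel_def p(1)[symmetric] prod.case p_def[symmetric] using p(2,3)
    by simp
qed

text \<open>Rotation by a quarter turn reduces every state to one with \<open>p > 0\<close> and \<open>q \<ge> 0\<close>.\<close>

lemma urn_kernel_quadrant:
  assumes "s \<noteq> (0, 0)"
  obtains p q :: nat and t1 t2 where
    "p > 0" "urn_lyap s = quad_lyap p q"
    "urn_lyap t1 = quad_lyap (real p) (real q + 1)" "q > 0 \<longrightarrow> urn_lyap t2 = quad_lyap (real p - 1) (real q)"
    "\<forall>f. (\<integral>\<^sup>+t. f t \<partial>urn_kernel s) = f t1 * ennreal (real p / (real p + real q)) + f t2 * ennreal (real q / (real p + real q))"
proof -
  obtain x y where s: "s = (x, y)" by force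
  consider "x > 0" "y \<ge> 0" | "x < 0" "y \<le> 0" | "x \<le> 0" "y > 0" | "x \<ge> 0" "y < 0"
    using assms s by fastforce
  then show thesis
  proof cases
    case 1
    show ?thesis
      by (rule that[of "nat x" "nat y" "(x, y + 1)" "(x - sgn y, y)"])
        (use 1 in \<open>auto simp: s urn_lyap_quadrant nn_integral_urn_kernel add.commute minus_diff_commute\<close>)
  next
    case 2
    show ?thesis
      by (rule that[of "nat (- x)" "nat (- y)" "(x, y - 1)" "(x - sgn y, y)"])
        (use 2 in \<open>auto simp: s urn_lyap_quadrant nn_integral_urn_kernel add.commute minus_diff_commute\<close>)
  next
    case 3
    show ?thesis
      by (rule that[of "nat y" "nat (- x)" "(x - 1, y)" "(x, y + sgn x)"])
        (use 3 in \<open>auto simp: s urn_lyap_quadrant nn_integral_urn_kernel add.commute minus_diff_commute\<close>)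
  next
    case 4
    show ?thesis
      by (rule that[of "nat (- y)" "nat x" "(x + 1, y)" "(x, y + sgn x)"])
        (use 4 in \<open>auto simp: s urn_lyap_quadrant nn_integral_urn_kernel add.commute minus_diff_commute\<close>)
  qed
qed

section \<open>The truncated potential and its superharmonicity\<close>

text \<open>Turns a lower bound on \<open>quad_lyap\<close> into one on the radius. Integrality
  enters through \<open>n \<le> n\<^sup>2\<close>; the constant rounds up
  \<open>1 + 5/3\<close>.\<close>

lemma quad_lyap_le:
  "quad_lyap (real p) (real q) \<le> 3 * ((real p)\<^sup>2 + (real q)\<^sup>2)\<^sup>2"
proof -
  define S where "S = (real p)\<^sup>2 + (real q)\<^sup>2"
  have sq: "real n \<le> (real n)\<^sup>2" for n
    by (cases n) (auto simp: power2_eq_square)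
  have "real p * real q \<ge> 0"
    by simp
  then have "real p * real q \<le> S"
    using sum_squares_bound[of "real p" "real q"] unfolding S_def by linarith
  moreover have "\<bar>real q - real p\<bar> \<le> S"
    using sq[of p] sq[of q] unfolding S_def abs_le_iff by linarith
  ultimately have "\<bar>real p * real q * (real q - real p)\<bar> \<le> S * S"
    unfolding abs_mult by (intro mult_mono) (auto simp: S_def)
  then show ?thesis
    unfolding quad_lyap_def S_def[symmetric] by (simp add: power2_eq_square)
qed

text \<open>By \<open>quad_lyap_le\<close>, a value of \<open>urn_lyap\<close> above the cut-off
  forces radius at least \<open>2000\<close>. Below the cut-off the potential is constant and
  maximal.\<close>

definition urn_potential :: "int \<times> int \<Rightarrow> real" where
  "urn_potential s = (max (3 * 2000 ^ 4) (urn_lyap s)) powr (-1/16)"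

lemma urn_potential_le: "urn_potential s \<le> (3 * 2000 ^ 4) powr (-1/16)"
  unfolding urn_potential_def by (intro powr_mono2') auto

text \<open>After a second-order expansion at both neighbours, the rate-weighted change is at most
  \<open>F / (16 * U\<^sup>2)\<close> times the difference of the two sides of
  \<open>quad_lyap_drift_dominates\<close>, which is negative.\<close>

lemma urn_potential_strict:
  assumes "urn_lyap s > 3 * 2000 ^ 4"
  shows "(\<integral>\<^sup>+t. ennreal (urn_potential t) \<partial>urn_kernel s) < ennreal (urn_potential s)"
proof -
  have "s \<noteq> (0, 0)"
    using assms by (auto simp: urn_lyap_def)
  then obtain p q :: nat and t1 t2 where *:
    "p > 0" "urn_lyap s = quad_lyap p q"
    "urn_lyap t1 = quad_lyap (real p) (real q + 1)" "q > 0 \<longrightarrow> urn_lyap t2 = quad_lyap (real p - 1) (real q)"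
    "\<forall>f. (\<integral>\<^sup>+t. f t \<partial>urn_kernel s) = f t1 * ennreal (real p / (real p + real q)) + f t2 * ennreal (real q / (real p + real q))"
    by (rule urn_kernel_quadrant)
  define U where "U = quad_lyap p q"
  define a where "a = quad_lyap (real p) (real q + 1) - U"
  define b where "b = quad_lyap (real p - 1) (real q) - U"
  define F where "F = U powr (-1/16)"
  have large: "(real p)\<^sup>2 + (real q)\<^sup>2 \<ge> 2000\<^sup>2"
  proof (rule ccontr)
    assume "\<not> ?thesis"
    then have "((real p)\<^sup>2 + (real q)\<^sup>2)\<^sup>2 \<le> (2000\<^sup>2)\<^sup>2"
      by (intro power_mono) auto
    then show False
      using quad_lyap_le[of p q] assms *(2) by simp
  qed
  have U: "U > 0" "\<bar>a / U\<bar> \<le> 1/20" "\<bar>b / U\<bar> \<le> 1/20"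
    using quad_lyap_increments_small[of p q] large
    by (simp_all add: U_def a_def b_def abs_divide divide_le_eq)
  have F: "F > 0" "urn_potential s = F"
    using U(1) assms *(2) by (auto simp: urn_potential_def F_def U_def max_def)
  \<comment> \<open>A neighbour may lie in the truncated region, but truncation only lowers the
    potential.\<close>
  have le: "urn_potential t \<le> F * (1 - c / (16 * U) + 9/256 * (c / U)\<^sup>2)"
    if t: "urn_lyap t = U + c" "\<bar>c / U\<bar> \<le> 1/20" for t c
  proof -
    have "U + c = U * (1 + c / U)" "1 + c / U > 0"
      using U(1) t(2) by (auto simp: field_simps)
    then have pos: "urn_lyap t > 0"
      using t U by simp
    have "urn_potential t \<le> urn_lyap t powr (-1/16)"
      unfolding urn_potential_def using pos by (intro powr_mono2') auto
    also have "\<dots> = F * (1 + c / U) powr (-1/16)"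
      unfolding t \<open>U + c = U * (1 + c / U)\<close> F_def
      by (rule powr_mult)
    also have "\<dots> \<le> F * (1 - c / U / 16 + 9/256 * (c / U)\<^sup>2)"
      using one_plus_powr_le[OF t(2)] F by (intro mult_left_mono) auto
    finally show ?thesis by (simp add: mult.commute)
  qed
  have pq: "real p + real q > 0"
    using *(1) by simp
  \<comment> \<open>For \<open>q = 0\<close> the second jump has weight \<open>0\<close>, and
    nothing is known about \<open>t2\<close>.\<close>
  have "real p * urn_potential t1 + real q * urn_potential t2 \<le>
    real p * (F * (1 - a / (16 * U) + 9/256 * (a / U)\<^sup>2)) + real q * (F * (1 - b / (16 * U) + 9/256 * (b / U)\<^sup>2))"
    using le[of t1 a] le[of t2 b] U *(3,4)
    by (cases "q = 0") (auto simp: a_def b_def intro!: add_mono mult_left_mono)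
  also have "\<dots> = (p + q) * F + F / (16 * U\<^sup>2) * (9/16 * (p * a\<^sup>2 + q * b\<^sup>2) - U * (p * a + q * b))"
    using U(1) by (simp add: field_simps power2_eq_square)
  also have "\<dots> < (p + q) * F"
  proof -
    have "9/16 * (p * a\<^sup>2 + q * b\<^sup>2) - U * (p * a + q * b) < 0"
      using quad_lyap_drift_dominates[of p q] large by (simp add: U_def a_def b_def)
    moreover have "F / (16 * U\<^sup>2) > 0"
      using F U by simp
    ultimately show ?thesis
      using mult_pos_neg by fastforce
  qed
  finally have "(real p * urn_potential t1 + real q * urn_potential t2) / (p + q) < F"
    using pq by (simp add: divide_less_eq mult.commute)
  moreover have "(\<integral>\<^sup>+t. ennreal (urn_potential t) \<partial>urn_kernel s) =
      ennreal ((real p * urn_potential t1 + real q * urn_potential t2) / (p + q))"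
    unfolding *(5)[rule_format] by (simp add: urn_potential_def add_divide_distrib mult.commute flip: ennreal_mult ennreal_plus)
  ultimately show ?thesis
    using F by (simp add: ennreal_lessI)
qed

text \<open>Truncated states carry the maximal value, which no average exceeds. This covers
  \<open>(0, 0)\<close> as well, since \<open>green_finite_of_supermartingale\<close> quantifies
  over the whole type.\<close>

lemma urn_potential_super: "(\<integral>\<^sup>+t. ennreal (urn_potential t) \<partial>urn_kernel s) \<le> ennreal (urn_potential s)"
proof (cases "urn_lyap s > 3 * 2000 ^ 4")
  case True
  then show ?thesis
    using urn_potential_strict by (simp add: less_imp_le)
next
  case False
  then have "urn_potential s = (3 * 2000 ^ 4) powr (-1/16)"
    by (simp add: urn_potential_def max_def)
  then have "(\<integral>\<^sup>+t. ennreal (urn_potential t) \<partial>urn_kernel s) \<le> (\<integral>\<^sup>+t. ennreal (urn_potential s) \<partial>urn_kernel s)"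
    using urn_potential_le by (intro nn_integral_mono ennreal_leI) simp
  then show ?thesis
    by (simp add: measure_pmf.emeasure_space_1)
qed

lemma urn_lyap_large:
  assumes "(real_of_int x)\<^sup>2 + (real_of_int y)\<^sup>2 \<ge> 10000\<^sup>2"
  shows "urn_lyap (x, y) > 3 * 2000 ^ 4"
proof -
  have *: "quad_lyap u v > 3 * 2000 ^ 4" if "u \<ge> 0" "v \<ge> 0" "u\<^sup>2 + v\<^sup>2 \<ge> 10000\<^sup>2" for u v
  proof -
    define r where "r = sqrt (u\<^sup>2 + v\<^sup>2)"
    have r: "r\<^sup>2 = u\<^sup>2 + v\<^sup>2" "r \<ge> 10000"
      unfolding r_def using that by (auto intro: real_le_rsqrt)
    have "3 * 2000 ^ 4 < (10000::real) ^ 3 * 9998" by simp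
    also have "\<dots> \<le> r ^ 3 * (r - 5/3)"
      using r(2) by (intro mult_mono power_mono) auto
    also have "\<dots> = r ^ 4 - 5/3 * r ^ 3"
      by (simp add: power_numeral_reduce algebra_simps)
    also have "\<dots> \<le> quad_lyap u v"
      using quad_lyap_increments(3)[OF that(1,2) _ r(1)] r(2) by simp
    finally show ?thesis .
  qed
  have "urn_lyap (x, y) = quad_lyap \<bar>x\<bar> \<bar>y\<bar> \<or> urn_lyap (x, y) = quad_lyap \<bar>y\<bar> \<bar>x\<bar>"
    using urn_lyap_quadrant[of x y] by (cases "x \<ge> 0"; cases "y \<ge> 0") auto
  then show ?thesis
    using *[of "\<bar>x\<bar>" "\<bar>y\<bar>"] *[of "\<bar>y\<bar>" "\<bar>x\<bar>"] assms by (auto simp: add.commute)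
qed

section \<open>Transience of the urn\<close>

lemma urn_kernel_steps_in_support:
  shows "x \<noteq> 0 \<Longrightarrow> (x, y + sgn x) \<in> set_pmf (urn_kernel (x, y))"
    and "y \<noteq> 0 \<Longrightarrow> (x - sgn y, y) \<in> set_pmf (urn_kernel (x, y))"
proof -
  define p where "p = real_of_int \<bar>x\<bar> / (real_of_int \<bar>x\<bar> + real_of_int \<bar>y\<bar>)"
  have p01: "0 \<le> p" "p \<le> 1"
    by (auto simp: p_def divide_le_eq)
  have "p > 0" if "x \<noteq> 0"
    using that by (simp add: p_def add_pos_nonneg)
  then show "x \<noteq> 0 \<Longrightarrow> (x, y + sgn x) \<in> set_pmf (urn_kernel (x, y))"
    using p01 unfolding urn_kernel_def prod.case p_def[symmetric]
    by (auto simp: set_pmf_iff intro!: image_eqI[where x = True])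
  have "p < 1" if "y \<noteq> 0"
    using that add_nonneg_pos[of "\<bar>real_of_int x\<bar>" "\<bar>real_of_int y\<bar>"]
    by (auto simp: p_def divide_less_eq)
  then show "y \<noteq> 0 \<Longrightarrow> (x - sgn y, y) \<in> set_pmf (urn_kernel (x, y))"
    using p01 unfolding urn_kernel_def prod.case p_def[symmetric]
    by (auto simp: set_pmf_iff intro!: image_eqI[where x = False])
qed

lemma set_pmf_urn_kernel: "set_pmf (urn_kernel (x, y)) \<subseteq> {(x, y + sgn x), (x - sgn y, y)}"
  by (auto simp: urn_kernel_def)

locale urn_chain = countable_markov_chain M "UNIV - {(0, 0)}" urn_kernel W
  for M :: "'w measure" and W :: "nat \<Rightarrow> 'w \<Rightarrow> int \<times> int"
begin

lemma green_finite_of_lyap: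
  assumes "urn_lyap s > 3 * 2000 ^ 4"
  shows "green s < \<infinity>"
proof -
  let ?Kf = "\<integral>\<^sup>+t. ennreal (urn_potential t) \<partial>urn_kernel s"
  note strict = urn_potential_strict[OF assms]
  show ?thesis
  proof (rule green_finite_of_supermartingale)
    show "ennreal (urn_potential s) \<le> ennreal ((3 * 2000 ^ 4) powr (-1/16))" for s
      by (intro ennreal_leI urn_potential_le)
    show "?Kf + (ennreal (urn_potential s) - ?Kf) \<le> ennreal (urn_potential s)"
      using strict by (simp add: add_diff_inverse_ennreal less_imp_le)
    show "0 < ennreal (urn_potential s) - ?Kf"
      using strict by (simp add: diff_gt_0_iff_gt_ennreal)
  qed (auto intro: urn_potential_super)
qed

text \<open>While \<open>x \<noteq> 0\<close>, vertical steps have positive probability and lead to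
  a large state; finiteness is pulled back along them. From the line \<open>x = 0\<close> one
  horizontal step comes first.\<close>

lemma green_finite: "s \<noteq> (0, 0) \<Longrightarrow> green s < \<infinity>"
proof -
  have vertical: "green (x, y) < \<infinity>" if "x \<noteq> 0" for x y
  proof -
    have descend: "green (x, y + int m * sgn x) < \<infinity> \<Longrightarrow> green (x, y) < \<infinity>" for m
    proof (induction m)
      case (Suc m)
      have "green (x, (y + int m * sgn x) + sgn x) < \<infinity>"
        using Suc.prems by (simp add: algebra_simps)
      then have "green (x, y + int m * sgn x) < \<infinity>"
        by (rule green_finite_of_step)
          (use urn_kernel_steps_in_support(1)[OF that] in \<open>simp add: pmf_positive_iff\<close>)
      then show ?case by (rule Suc.IH)
    qed simp
    \<comment> \<open>The summand \<open>\<bar>y\<bar>\<close> pays for a start on the side opposite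
      to the direction of motion.\<close>
    define m where "m = nat (\<bar>y\<bar> + 10000)"
    define z where "z = y + int m * sgn x"
    have "\<bar>z\<bar> \<ge> 10000"
      using that by (cases "x > 0") (auto simp: z_def m_def sgn_if)
    then have "\<bar>10000\<bar> \<le> \<bar>real_of_int z\<bar>"
      by linarith
    then have "10000\<^sup>2 \<le> (real_of_int z)\<^sup>2"
      by (simp only: abs_le_square_iff)
    then have "urn_lyap (x, z) > 3 * 2000 ^ 4"
      by (intro urn_lyap_large) (simp add: add_increasing)
    then show ?thesis
      using descend[of m] green_finite_of_lyap by (simp add: z_def)
  qed
  assume s: "s \<noteq> (0, 0)"
  show "green s < \<infinity>"
  proof (cases "fst s = 0")
    case True
    then obtain y where y: "s = (0, y)" "y \<noteq> 0"
      using s by (cases s) auto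
    have "green (0 - sgn y, y) < \<infinity>"
      using y by (intro vertical) (simp add: sgn_if)
    then show ?thesis
      unfolding y(1) by (rule green_finite_of_step)
        (use urn_kernel_steps_in_support(2)[OF y(2), of 0] in \<open>simp add: pmf_positive_iff\<close>)
  next
    case False
    then show ?thesis
      using vertical by (cases s) auto
  qed
qed

lemma transient: "transient_process M W"
  by (rule transient_of_green_finite, rule green_finite) auto

end

section \<open>Visits to the axes\<close>

definition on_axis :: "int \<times> int \<Rightarrow> bool" where
  "on_axis s \<longleftrightarrow> fst s * snd s = 0"

text \<open>Inside a quadrant one coordinate only moves towards \<open>0\<close> and the other only away from it:
  \<open>shrinking\<close> is the modulus of the former and \<open>grow\<close> is the step of the latter.\<close>

definition shrinking :: "int \<times> int \<Rightarrow> nat" where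
  "shrinking = (\<lambda>(x, y). if x * y > 0 then nat \<bar>x\<bar> else nat \<bar>y\<bar>)"

definition grow :: "int \<times> int \<Rightarrow> int \<times> int" where
  "grow = (\<lambda>(x, y). if x * y > 0 then (x, y + sgn x) else (x - sgn y, y))"

lemma quadrant_cases:
  assumes "\<not> on_axis (x, y)"
  obtains "x > 0" "y > 0" | "x < 0" "y < 0" | "x < 0" "y > 0" | "x > 0" "y < 0"
  using assms by (fastforce simp: on_axis_def)

lemma grow_in_quadrant:
  assumes "\<not> on_axis s"
  shows "\<not> on_axis (grow s)" and "shrinking (grow s) = shrinking s"
proof -
  obtain x y where s: "s = (x, y)" by force
  from assms[unfolded s] show "\<not> on_axis (grow s)" "shrinking (grow s) = shrinking s"
    by (cases rule: quadrant_cases;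
        auto simp: s on_axis_def grow_def shrinking_def zero_less_mult_iff)+
qed

lemma funpow_grow_in_quadrant:
  assumes "\<not> on_axis s"
  shows "\<not> on_axis ((grow ^^ k) s) \<and> shrinking ((grow ^^ k) s) = shrinking s"
  by (induction k) (auto simp: assms grow_in_quadrant)

text \<open>The other possible step lowers the shrinking coordinate by one; as \<open>t\<close> is
  off the axes, the quadrant and hence the roles of the coordinates are unchanged.\<close>

lemma urn_step_in_quadrant:
  assumes "\<not> on_axis s" "\<not> on_axis t" "t \<in> set_pmf (urn_kernel s)"
  shows "t = grow s \<or> shrinking t < shrinking s"
proof -
  obtain x y where s: "s = (x, y)" by force
  have t: "t = (x, y + sgn x) \<or> t = (x - sgn y, y)"
    using assms(3) set_pmf_urn_kernel[of x y] by (auto simp: s)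
  from assms(1)[unfolded s] show ?thesis
    using t assms(2)
    by (cases rule: quadrant_cases)
      (auto simp: s on_axis_def grow_def shrinking_def zero_less_mult_iff)
qed

text \<open>The growing coordinate has modulus at least \<open>1\<close>. The bound depends only on
  \<open>shrinking s\<close>, which is constant along \<open>grow\<close>, so it is uniform along a
  deterministic path.\<close>

lemma pmf_urn_kernel_grow:
  assumes "\<not> on_axis s"
  shows "pmf (urn_kernel s) (grow s) \<le> real (shrinking s) / (real (shrinking s) + 1)"
proof -
  obtain x y where s: "s = (x, y)" by force
  define p where "p = real_of_int \<bar>x\<bar> / (real_of_int \<bar>x\<bar> + real_of_int \<bar>y\<bar>)"
  have xy: "x \<noteq> 0" "y \<noteq> 0"
    using assms by (auto simp: s on_axis_def)
  then have ge1: "real_of_int \<bar>x\<bar> \<ge> 1" "real_of_int \<bar>y\<bar> \<ge> 1"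
    by linarith+
  then have p: "0 \<le> p" "p \<le> 1" "1 - p = real_of_int \<bar>y\<bar> / (real_of_int \<bar>x\<bar> + real_of_int \<bar>y\<bar>)"
    by (auto simp: p_def field_simps)
  let ?h = "\<lambda>b. if b then (x, y + sgn x) else (x - sgn y, y)"
  have "inj ?h"
    using xy by (auto simp: inj_def sgn_if)
  then have pmf: "pmf (urn_kernel s) (?h b) = pmf (bernoulli_pmf p) b" for b
    unfolding s urn_kernel_def prod.case p_def by (rule pmf_map_inj')
  show ?thesis
  proof (cases "x * y > 0")
    case True
    have "pmf (urn_kernel s) (grow s) = p"
      using pmf[of True] p True by (simp add: s grow_def)
    also have "p \<le> real_of_int \<bar>x\<bar> / (real_of_int \<bar>x\<bar> + 1)"
      unfolding p_def using ge1 by (intro divide_left_mono) auto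
    finally show ?thesis
      using True by (simp add: s shrinking_def)
  next
    case False
    have "pmf (urn_kernel s) (grow s) = 1 - p"
      using pmf[of False] p False by (simp add: s grow_def)
    also have "1 - p \<le> real_of_int \<bar>y\<bar> / (real_of_int \<bar>y\<bar> + 1)"
      unfolding p(3) using ge1 by (intro divide_left_mono) auto
    finally show ?thesis
      using False by (simp add: s shrinking_def)
  qed
qed

context urn_chain
begin

lemma AE_leaves_grow_path:
  "AE \<omega> in M. \<forall>N s. \<not> on_axis s \<longrightarrow> (\<exists>i\<ge>N. W i \<omega> \<noteq> (grow ^^ (i - N)) s)"
proof -
  have "AE \<omega> in M. \<exists>i\<ge>N. W i \<omega> \<noteq> (grow ^^ (i - N)) s" if "\<not> on_axis s" for N s
  proof (rule AE_leaves_path)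
    fix i assume "i \<ge> N"
    then show "pmf (urn_kernel ((grow ^^ (i - N)) s)) ((grow ^^ (Suc i - N)) s)
        \<le> real (shrinking s) / (real (shrinking s) + 1)"
      using pmf_urn_kernel_grow[of "(grow ^^ (i - N)) s"] funpow_grow_in_quadrant[OF that, of "i - N"] by (simp add: Suc_diff_le)
  qed (simp add: divide_less_eq)
  then show ?thesis
    unfolding AE_all_countable by auto
qed

lemma AE_on_axis_infinitely_often: "AE \<omega> in M. \<forall>N. \<exists>n>N. on_axis (W n \<omega>)"
  using AE_leaves_grow_path AE_state_step_in_support
proof eventually_elim
  case (elim \<omega>)
  show ?case
  proof (rule ccontr)
    assume "\<not> (\<forall>N. \<exists>n>N. on_axis (W n \<omega>))"
    then obtain N where N: "\<not> on_axis (W n \<omega>)" if "n > N" for n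
      by blast
    \<comment> \<open>From a time of least \<open>shrinking\<close> value on, no step can decrease
      it, so every step is a \<open>grow\<close> step.\<close>
    obtain m where m: "m > N" and least: "\<And>n. n > N \<Longrightarrow> shrinking (W m \<omega>) \<le> shrinking (W n \<omega>)"
      using ex_has_least_nat[of "\<lambda>n. n > N" "Suc N" "\<lambda>n. shrinking (W n \<omega>)"] by auto
    have path: "W (m + k) \<omega> = (grow ^^ k) (W m \<omega>)" for k
    proof (induction k)
      case (Suc k)
      have "shrinking (W (m + k) \<omega>) = shrinking (W m \<omega>)"
        using funpow_grow_in_quadrant[OF N[OF m]] by (simp add: Suc.IH)
      then have "\<not> shrinking (W (Suc (m + k)) \<omega>) < shrinking (W (m + k) \<omega>)"
        using least[of "Suc (m + k)"] m by simp
      then have "W (Suc (m + k)) \<omega> = grow (W (m + k) \<omega>)"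
        using urn_step_in_quadrant[of "W (m + k) \<omega>" "W (Suc (m + k)) \<omega>"] elim(2) N m by auto
      then show ?case
        by (simp add: Suc.IH)
    qed simp
    obtain i where "i \<ge> m" "W i \<omega> \<noteq> (grow ^^ (i - m)) (W m \<omega>)"
      using elim(1) N[OF m] by blast
    then show False
      using path[of "i - m"] by simp
  qed
qed

end

text \<open>On such a path each \<open>LEAST\<close> is attained, so the axis times increase
  strictly.\<close>

lemma axis_time_ge:
  assumes "\<forall>N. \<exists>n>N. X n \<omega> * Y n \<omega> = 0"
  shows "k \<le> axis_time X Y k \<omega>"
proof (induction k)
  case (Suc k)
  have "\<exists>n. n > axis_time X Y k \<omega> \<and> X n \<omega> * Y n \<omega> = 0"
    using assms by blast
  from LeastI_ex[OF this] have "axis_time X Y (Suc k) \<omega> > axis_time X Y k \<omega>"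
    by simp
  with Suc show ?case
    by linarith
qed simp

theorem theorem2p1:
  fixes M :: "'w measure" and z0 :: nat and X Y :: "nat \<Rightarrow> 'w \<Rightarrow> int"
  assumes "z0 \<ge> 1"
    and "simple_harmonic_urn M z0 X Y"
  shows "transient_process M (embedded_process X Y) \<and>
         transient_process M (\<lambda>n \<omega>. (X n \<omega>, Y n \<omega>))"
proof -
  have chain: "markov_chain M (UNIV - {(0, 0)}) urn_kernel (\<lambda>n \<omega>. (X n \<omega>, Y n \<omega>))"
    using assms(2) by (simp add: simple_harmonic_urn_def)
  interpret urn_chain M "\<lambda>n \<omega>. (X n \<omega>, Y n \<omega>)"
    using chain
    by (intro urn_chain.intro countable_markov_chain.intro countable_markov_chain_axioms.intro)
      (auto simp: markov_chain_def)
  have "transient_process M (embedded_process X Y)"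
    using transient[unfolded transient_process_def] AE_on_axis_infinitely_often
    unfolding transient_process_def
  proof eventually_elim
    case (elim \<omega>)
    have ge: "k \<le> axis_time X Y k \<omega>" for k
      using elim(2) by (intro axis_time_ge) (simp add: on_axis_def)
    show ?case
    proof (intro allI impI)
      fix F :: "nat set" assume "finite F"
      then obtain b where b: "\<forall>n\<in>F. n \<le> b"
        unfolding finite_nat_set_iff_bounded_le by blast
      \<comment> \<open>An embedded value of at most \<open>b\<close> puts both coordinates into
        this box.\<close>
      define G where "G = {- int b..int b} \<times> {- int b..int b}"
      have "finite G"
        by (simp add: G_def)
      then have "\<forall>\<^sub>F n in sequentially. (X n \<omega>, Y n \<omega>) \<notin> G"
        using elim(1) by blast
      moreover have "filterlim (\<lambda>k. axis_time X Y k \<omega>) sequentially sequentially"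
        using ge by (intro filterlim_at_top_mono[OF filterlim_ident]) auto
      ultimately have "\<forall>\<^sub>F k in sequentially.
          (X (axis_time X Y k \<omega>) \<omega>, Y (axis_time X Y k \<omega>) \<omega>) \<notin> G"
        by (rule eventually_compose_filterlim)
      then show "\<forall>\<^sub>F k in sequentially. embedded_process X Y k \<omega> \<notin> F"
        by (rule eventually_mono) (use b in \<open>force simp: embedded_process_def G_def\<close>)
    qed
  qed
  with transient show ?thesis
    by simp
qed

end
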